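(* Let $s\in(0,1)$. Let $\varphi:\mathbb{R}^{N-1}\to\mathbb{R}$ be continuous with $\lim_{|x'|\to+\infty}\varphi(x')=+\infty$, and let $\Omega=\{x=(x',x_N)\in\mathbb{R}^N: x_N>\varphi(x')\}$. Let $f=f(x,t)$ be continuous in $\overline\Omega\times\mathbb{R}$, non-decreasing in $x_N$, and locally Lipschitz continuous in $t$, locally uniformly in $x$, in the following sense: for any $M>0$ and any compact set $K\subset\overline\Omega$ there exists $C>0$ such that $$\sup_{x\in K}\frac{|f(x,t)-f(x,\tau)|}{|t-\tau|}\le C\qquad\text{for any } t,\tau\in[-M,M],\ t\neq\tau.$$ Let $u$ be a solution (not necessarily bounded) to $$(-\Delta)^s u=f(x,u)\ \text{ in }\Omega,\qquad u>0\ \text{ in }\Omega,\qquad u=0\ \text{ in }\mathbb{R}^N\setminus\Omega.$$ Then $u$ is monotone increasing in $x_N$, that is, $u(x',x_N)<u(x',y_N)$ whenever $(x',x_N)\in\Omega$ and $y_N>x_N$.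
   Context: Points of $\mathbb{R}^N$ are written $x=(x',x_N)$ with $x'\in\mathbb{R}^{N-1}$. For $s\in(0,1)$ the fractional Laplacian is $(-\Delta)^s u(x)=c_{N,s}\lim_{\varepsilon\to0^+}\int_{\mathbb{R}^N\setminus B_\varepsilon(x)}\frac{u(x)-u(y)}{|x-y|^{N+2s}}\,dy$, where $c_{N,s}>0$ is a normalizing constant. "Solution" means classical solution: a continuous function $u:\mathbb{R}^N\to\mathbb{R}$ such that $(-\Delta)^s u(x)$ is well defined and equal to the right-hand side at every point $x$ of $\Omega$, and which satisfies the prescribed exterior condition a.e. in $\mathbb{R}^N\setminus\Omega$. *)

theory Defs
  imports "HOL-Analysis.Analysis"
begin

text \<open>
  A point \<open>x = (x', x\<^sub>N)\<close> of \<open>\<real>\<^sup>N\<close> is a pair of type \<open>(real ^ 'n) \<times> real\<close>,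
  so that \<open>N = CARD('n) + 1 \<ge> 2\<close>. The product norm is the Euclidean norm
  and \<open>lborel\<close> is Lebesgue measure.
\<close>

definition strict_epigraph :: "(real ^ 'n \<Rightarrow> real) \<Rightarrow> ((real ^ 'n) \<times> real) set" where
  "strict_epigraph \<phi> = {x. snd x > \<phi> (fst x)}"

text \<open>
  \<open>has_frac_laplacian c s u x v\<close>: \<open>(-\<Delta>)\<^sup>s u(x)\<close> is well defined and equal to \<open>v\<close>, where
  \<open>c\<close> is the normalizing constant. Integrability on the complement of each ball is required
  explicitly, because the Bochner integral of a non-integrable function is \<open>0\<close> by convention.
\<close>

definition has_frac_laplacian ::
  "real \<Rightarrow> real \<Rightarrow> ('a::euclidean_space \<Rightarrow> real) \<Rightarrow> 'a \<Rightarrow> real \<Rightarrow> bool" where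
  "has_frac_laplacian c s u x v \<longleftrightarrow>
     (\<forall>\<epsilon>>0. set_integrable lborel (- ball x \<epsilon>)
        (\<lambda>y. (u x - u y) / norm (x - y) powr (real DIM('a) + 2 * s))) \<and>
     ((\<lambda>\<epsilon>. c * (LINT y:(- ball x \<epsilon>)|lborel.
        (u x - u y) / norm (x - y) powr (real DIM('a) + 2 * s))) \<longlongrightarrow> v) (at_right 0)"

text \<open>
  Classical solutions of \<open>(-\<Delta>)\<^sup>s u = f(x,u)\<close> in \<open>\<Omega>\<close>, \<open>u = g\<close> in the complement of \<open>\<Omega>\<close>.
\<close>

definition classical_solution ::
  "real \<Rightarrow> real \<Rightarrow> 'a::euclidean_space set \<Rightarrow> ('a \<Rightarrow> real \<Rightarrow> real) \<Rightarrow> ('a \<Rightarrow> real)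
     \<Rightarrow> ('a \<Rightarrow> real) \<Rightarrow> bool" where
  "classical_solution c s \<Omega> f g u \<longleftrightarrow>
     continuous_on UNIV u \<and>
     (\<forall>x\<in>\<Omega>. has_frac_laplacian c s u x (f x (u x))) \<and>
     (AE x in lborel. x \<notin> \<Omega> \<longrightarrow> u x = g x)"

definition nondecreasing_last_on ::
  "((real ^ 'n) \<times> real) set \<Rightarrow> ((real ^ 'n) \<times> real \<Rightarrow> real \<Rightarrow> real) \<Rightarrow> bool" where
  "nondecreasing_last_on S f \<longleftrightarrow>
     (\<forall>x' a b t. (x', a) \<in> S \<longrightarrow> (x', b) \<in> S \<longrightarrow> a \<le> b \<longrightarrow> f (x', a) t \<le> f (x', b) t)"

text \<open>
  The bound on the supremum over \<open>K\<close> is written pointwise, which also covers \<open>K = {}\<close> and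
  avoids the arbitrary value of \<open>Sup\<close> on unbounded sets.
\<close>

definition locally_lipschitz_in_t_on ::
  "'a::topological_space set \<Rightarrow> ('a \<Rightarrow> real \<Rightarrow> real) \<Rightarrow> bool" where
  "locally_lipschitz_in_t_on S f \<longleftrightarrow>
     (\<forall>M>0. \<forall>K. compact K \<and> K \<subseteq> S \<longrightarrow>
        (\<exists>C>0. \<forall>t\<in>{-M..M}. \<forall>\<tau>\<in>{-M..M}. t \<noteq> \<tau> \<longrightarrow>
           (\<forall>x\<in>K. \<bar>f x t - f x \<tau>\<bar> / \<bar>t - \<tau>\<bar> \<le> C)))"

end

theory Submission imports Defs begin

text \<open>
  Moving planes. For the reflected difference \<open>w\<^sub>l(x) = u(x', 2l - x\<^sub>N) - u(x)\<close>, folding the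
  singular integral along \<open>{x\<^sub>N = l}\<close> has two consequences at a minimum \<open>x\<close> of \<open>w\<^sub>l\<close> over
  \<open>{x\<^sub>N < l}\<close>. If \<open>w\<^sub>l(x) < 0\<close>, then \<open>(-\<Delta>)\<^sup>s w\<^sub>l(x) \<le> - C d\<^sup>-\<^sup>2\<^sup>s \<bar>w\<^sub>l(x)\<bar>\<close>, where \<open>d = l - x\<^sub>N\<close>; the
  equation and the Lipschitz bound on \<open>f\<close> then force \<open>d\<close> to be at least some \<open>d\<^sub>0 > 0\<close>, uniformly
  for bounded \<open>l\<close>. If \<open>w\<^sub>l(x) = 0\<close>, then \<open>(-\<Delta>)\<^sup>s w\<^sub>l(x) < 0\<close>, since \<open>w\<^sub>l\<close> is positive far
  below \<open>\<Omega>\<close>; the equation and the monotonicity of \<open>f\<close> exclude this. The pairs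
  \<open>(l, x)\<close> with \<open>x\<^sub>N \<le> l - d\<^sub>0\<close> and \<open>w\<^sub>l(x) \<le> 0\<close> form a compact set, and at one with
  least \<open>l\<close> the value \<open>w\<^sub>l(x)\<close> is a zero minimum; so there are none. No bound on \<open>u\<close> is
  needed, because only pointwise evaluations at minima occur.
\<close>

section \<open>Reflection in a horizontal hyperplane and invariance of Lebesgue measure\<close>

definition hreflect :: "real \<Rightarrow> 'a \<times> real \<Rightarrow> 'a \<times> real" where
  "hreflect l x = (fst x, 2 * l - snd x)"

lemma fst_hreflect [simp]: "fst (hreflect l x) = fst x"
  and snd_hreflect [simp]: "snd (hreflect l x) = 2 * l - snd x"
  and hreflect_hreflect [simp]: "hreflect l (hreflect l x) = x"
  by (simp_all add: hreflect_def)

lemma continuous_on_hreflect [continuous_intros]: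
  fixes g :: "'b::topological_space \<Rightarrow> 'a::topological_space \<times> real"
  assumes "continuous_on S f" and "continuous_on S g"
  shows "continuous_on S (\<lambda>x. hreflect (f x) (g x))"
  unfolding hreflect_def by (intro continuous_intros assms)

lemma measurable_hreflect [measurable]:
  "hreflect l \<in> borel_measurable (borel :: ('a::euclidean_space \<times> real) measure)"
  by (intro borel_measurable_continuous_onI continuous_intros)

lemma norm_hreflect_diff:
  fixes x y :: "'a::euclidean_space \<times> real"
  shows "norm (hreflect l x - hreflect l y) = norm (x - y)"
  by (simp add: norm_prod_def power2_commute)

text \<open>The reflection is affine with a diagonal linear part: entry -1 on the last axis
  \<open>e\<close>, and 1 on all others. The Jacobian factor is therefore 1.\<close>

lemma distr_lborel_hreflect:
  "distr lborel borel (hreflect l) = (lborel :: ('a::euclidean_space \<times> real) measure)"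
proof -
  define e :: "'a \<times> real" where "e = (0, 1)"
  define c where "c j = (if j = e then - 1 else 1 :: real)" for j
  have e: "e \<in> Basis" by (auto simp: e_def Basis_prod_def)
  have T: "(0, 2 * l) + (\<Sum>j\<in>Basis. (c j * (x \<bullet> j)) *\<^sub>R j) = hreflect l x" for x :: "'a \<times> real"
  proof -
    have "(\<Sum>j\<in>Basis. (c j * (x \<bullet> j)) *\<^sub>R j)
        = (\<Sum>j\<in>Basis. (x \<bullet> j) *\<^sub>R j - (if j = e then (2 * (x \<bullet> e)) *\<^sub>R e else 0))"
      by (intro sum.cong) (auto simp: c_def algebra_simps simp flip: scaleR_add_left)
    also have "\<dots> = x - (2 * (x \<bullet> e)) *\<^sub>R e"
      using e by (simp add: sum_subtractf euclidean_representation)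
    finally show ?thesis
      by (simp add: hreflect_def e_def prod_eq_iff inner_prod_def)
  qed
  have "lborel = density (distr lborel borel
      (\<lambda>x. (0, 2 * l) + (\<Sum>j\<in>Basis. (c j * (x \<bullet> j)) *\<^sub>R j))) (\<lambda>_::'a \<times> real. \<Prod>j\<in>Basis. \<bar>c j\<bar>)"
    by (rule lborel_affine_euclidean) (auto simp: c_def)
  also have "(\<Prod>j\<in>Basis. \<bar>c j\<bar>) = 1"
    by (intro prod.neutral) (auto simp: c_def)
  finally show ?thesis
    by (simp add: T density_1)
qed

lemma integrable_hreflect_iff:
  fixes g :: "'a::euclidean_space \<times> real \<Rightarrow> real"
  assumes "g \<in> borel_measurable borel"
  shows "integrable lborel (\<lambda>y. g (hreflect l y)) \<longleftrightarrow> integrable lborel g"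
  using integrable_distr_eq[of "hreflect l" lborel borel g] assms
  by (simp add: distr_lborel_hreflect)

lemma integral_hreflect:
  fixes g :: "'a::euclidean_space \<times> real \<Rightarrow> real"
  assumes "g \<in> borel_measurable borel"
  shows "(LINT y|lborel. g (hreflect l y)) = integral\<^sup>L lborel g"
  using integral_distr[of "hreflect l" lborel borel g] assms
  by (simp add: distr_lborel_hreflect)

section \<open>Fractional Laplacian of reflections and differences\<close>

text \<open>The kernel depends only on distances, and the reflection is a measure-preserving
  isometry carrying balls to balls. So every truncated integral is unchanged before the limit is
  taken.\<close>

lemma has_frac_laplacian_hreflect:
  fixes u :: "'a::euclidean_space \<times> real \<Rightarrow> real"
  assumes u: "continuous_on UNIV u" and L: "has_frac_laplacian c s u (hreflect l x) v"
  shows "has_frac_laplacian c s (\<lambda>y. u (hreflect l y)) x v"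
proof -
  let ?p = "real DIM('a \<times> real) + 2 * s"
  have [measurable]: "u \<in> borel_measurable borel"
    by (rule borel_measurable_continuous_onI[OF u])
  let ?g = "\<lambda>e y. indicator (- ball (hreflect l x) e) y *\<^sub>R
      ((u (hreflect l x) - u y) / norm (hreflect l x - y) powr ?p)"
  have eq: "?g e (hreflect l y) = indicator (- ball x e) y *\<^sub>R
      ((u (hreflect l x) - u (hreflect l y)) / norm (x - y) powr ?p)" for e y
    using norm_hreflect_diff[of l x y] by (simp add: indicator_def dist_norm)
  have m: "?g e \<in> borel_measurable borel" for e by measurable
  have "set_integrable lborel (- ball x e) (\<lambda>y. (u (hreflect l x) - u (hreflect l y)) / norm (x - y) powr ?p)
      \<longleftrightarrow> set_integrable lborel (- ball (hreflect l x) e)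
        (\<lambda>y. (u (hreflect l x) - u y) / norm (hreflect l x - y) powr ?p)" for e
    using integrable_hreflect_iff[OF m, of e l] unfolding eq set_integrable_def .
  moreover have "(LINT y:(- ball x e)|lborel. (u (hreflect l x) - u (hreflect l y)) / norm (x - y) powr ?p)
      = (LINT y:(- ball (hreflect l x) e)|lborel.
          (u (hreflect l x) - u y) / norm (hreflect l x - y) powr ?p)" for e
    using integral_hreflect[OF m, of e l] unfolding eq set_lebesgue_integral_def .
  ultimately show ?thesis
    using L unfolding has_frac_laplacian_def by (simp del: DIM_prod)
qed

lemma has_frac_laplacian_diff:
  assumes "has_frac_laplacian c s u x a" and "has_frac_laplacian c s v x b"
  shows "has_frac_laplacian c s (\<lambda>y. u y - v y) x (a - b)"
proof -
  let ?p = "real DIM('a) + 2 * s"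
  have eq: "(u x - v x - (u y - v y)) / norm (x - y) powr ?p
      = (u x - u y) / norm (x - y) powr ?p - (v x - v y) / norm (x - y) powr ?p" for y
    by (simp add: diff_divide_distrib)
  have 1: "set_integrable lborel (- ball x e) (\<lambda>y. (u x - u y) / norm (x - y) powr ?p)"
       "set_integrable lborel (- ball x e) (\<lambda>y. (v x - v y) / norm (x - y) powr ?p)" if "e > 0" for e
    using assms that by (auto simp: has_frac_laplacian_def)
  have "((\<lambda>e. c * (LINT y:(- ball x e)|lborel. (u x - u y) / norm (x - y) powr ?p)
        - c * (LINT y:(- ball x e)|lborel. (v x - v y) / norm (x - y) powr ?p)) \<longlongrightarrow> a - b) (at_right 0)"
    using assms by (intro tendsto_diff) (auto simp: has_frac_laplacian_def)
  then have "((\<lambda>e. c * (LINT y:(- ball x e)|lborel. (u x - v x - (u y - v y)) / norm (x - y) powr ?p))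
      \<longlongrightarrow> a - b) (at_right 0)"
    by (rule Lim_transform_eventually)
      (auto simp: eventually_at_right_less eq 1 set_integral_diff right_diff_distrib
        intro!: eventually_mono[OF eventually_at_right_less[of 0]])
  then show ?thesis
    using 1 unfolding has_frac_laplacian_def eq by auto
qed

section \<open>Reflected kernel and minima of antisymmetric functions\<close>

text \<open>Only the last coordinates matter: the squared distances differ by 4 (l - x_N) (l -
  y_N).\<close>

lemma norm_diff_hreflect_less:
  fixes x y :: "'a::euclidean_space \<times> real"
  assumes "snd x < l" and "snd y < l"
  shows "norm (x - y) < norm (x - hreflect l y)"
proof -
  have "(snd x - (2 * l - snd y))\<^sup>2 - (snd x - snd y)\<^sup>2 = 4 * ((l - snd x) * (l - snd y))"
    by (simp add: power2_eq_square algebra_simps)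
  moreover have "(l - snd x) * (l - snd y) > 0"
    using assms by simp
  ultimately show ?thesis
    by (simp add: norm_prod_def)
qed

lemma norm_diff_hreflect_ge:
  fixes x y :: "'a::euclidean_space \<times> real"
  assumes "snd y \<le> l"
  shows "l - snd x \<le> norm (x - hreflect l y)"
proof -
  have "l - snd x \<le> dist (snd x) (snd (hreflect l y))"
    using assms by (simp add: dist_real_def)
  also have "\<dots> \<le> norm (x - hreflect l y)"
    using dist_snd_le[of x "hreflect l y"] by (simp add: dist_norm)
  finally show ?thesis .
qed

lemma inverse_norm_powr_hreflect_less:
  fixes x y :: "'a::euclidean_space \<times> real"
  assumes "0 < p" and "snd x < l" and "snd y < l" and "y \<noteq> x"
  shows "1 / norm (x - hreflect l y) powr p < 1 / norm (x - y) powr p"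
proof -
  have "norm (x - y) > 0" using assms by simp
  then have "norm (x - y) powr p < norm (x - hreflect l y) powr p"
    using norm_diff_hreflect_less[of x l y] assms by (intro powr_less_mono2) auto
  then show ?thesis
    using \<open>norm (x - y) > 0\<close> by (intro divide_strict_left_mono mult_pos_pos) auto
qed

text \<open>
  Pairing each point with its mirror image replaces the singular integral over the whole space by
  the kernel difference on the half space. The part of the half space inside the removed ball
  contributes \<open>O(\<epsilon>\<^sup>N)\<close>, because the mirror image of that ball is not removed.
\<close>

lemma frac_laplacian_antisymmetric_min_le:
  fixes w :: "'a::euclidean_space \<times> real \<Rightarrow> real" and s c l v \<eta> :: real
  defines "K \<equiv> \<lambda>z. 1 / norm z powr (real DIM('a \<times> real) + 2 * s)"
  assumes "0 < s" and "0 < c"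
    and cont: "continuous_on UNIV w"
    and anti: "\<And>y. w (hreflect l y) = - w y"
    and lap: "has_frac_laplacian c s w x v"
    and x: "snd x < l" and wx: "w x \<le> 0"
    and min: "\<And>y. snd y < l \<Longrightarrow> w x \<le> w y"
    and A: "A \<in> sets borel" "A \<subseteq> {y. snd y < l}" "emeasure lborel A < \<infinity>"
    and "0 \<le> \<eta>"
    and gain: "\<And>y. y \<in> A \<Longrightarrow>
      (w x - w y) * (K (x - y) - K (x - hreflect l y)) + 2 * w x * K (x - hreflect l y) \<le> - \<eta>"
  shows "v \<le> - (c * \<eta> * measure lborel A)"
proof -
  define p where "p = real DIM('a \<times> real) + 2 * s"
  have p: "p > 0" using assms(2) by (simp add: p_def add_pos_pos)
  have K: "K z = 1 / norm z powr p" for z by (simp add: K_def p_def)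
  have K0: "K z \<ge> 0" for z by (simp add: K)
  define d where "d = l - snd x"
  have d: "d > 0" using x by (simp add: d_def)
  have Kd: "K (x - hreflect l y) \<le> 1 / d powr p" if "snd y \<le> l" for y
    unfolding K using d p norm_diff_hreflect_ge[OF that, of x]
    by (intro divide_left_mono powr_mono2 mult_pos_pos) (auto simp: d_def)
  have KK: "K (x - hreflect l y) \<le> K (x - y)" if "snd y < l" "y \<noteq> x" for y
    unfolding K using inverse_norm_powr_hreflect_less[OF p x that] by simp
  \<comment> \<open>In the removed ball the folded integrand is at most \<open>1 / d powr p\<close>.
    The extra \<eta> offsets the \<open>- \<eta>\<close> that the majorant \<open>G\<close> below
    carries on \<open>A\<close>.\<close>
  define P where "P = 1 / d powr p + \<eta>"
  have P: "P \<ge> \<eta>" by (simp add: P_def)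
  \<comment> \<open>With \<open>w x \<le> 0\<close>, this makes \<open>w x + w y \<le> 1\<close> on
    the removed ball.\<close>
  obtain r where r: "r > 0" "\<And>y. dist y x < r \<Longrightarrow> dist (w y) (w x) < 1"
    using cont unfolding continuous_on_iff by (metis UNIV_I zero_less_one)
  have [measurable]: "w \<in> borel_measurable borel"
    by (rule borel_measurable_continuous_onI[OF cont])
  define I where "I e = (LINT y:(- ball x e)|lborel. (w x - w y) / norm (x - y) powr p)" for e
  define V where "V = measure lborel A"
  \<comment> \<open>\<open>e < d\<close> keeps the ball strictly below the plane, and
    \<open>e < r\<close> gives the bound on \<open>w\<close> there.\<close>
  have I_le: "I e \<le> - \<eta> * V + P * measure lborel (ball x e)" if e: "0 < e" "e < min d r" for e
  proof -
    define H where "H y = indicator (- ball x e) y * ((w x - w y) * K (x - y))" for y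
    have [measurable]: "H \<in> borel_measurable borel"
      unfolding H_def K by measurable
    have intH: "integrable lborel H"
      using lap e unfolding has_frac_laplacian_def set_integrable_def H_def K p_def by simp
    have IH: "I e = integral\<^sup>L lborel H"
      unfolding I_def set_lebesgue_integral_def H_def K by simp
    have intHR: "integrable lborel (\<lambda>y. H (hreflect l y))"
      using integrable_hreflect_iff[of H l] intH by simp
    have [measurable]: "ball x e \<in> sets borel" by simp
    define G where "G y = - \<eta> * indicator A y + P * indicator (ball x e) y" for y
    have G_meas [measurable]: "G \<in> borel_measurable borel"
      using A(1) unfolding G_def by measurable
    have fb: "emeasure lborel (ball x e) < \<infinity>"
      by (rule emeasure_bounded_finite) simp
    have intG: "integrable lborel G"
      unfolding G_def using A fb by (intro Bochner_Integration.integrable_add integrable_mult_right) auto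
    have iG: "integral\<^sup>L lborel G = - \<eta> * V + P * measure lborel (ball x e)"
      unfolding G_def V_def using A fb by (subst Bochner_Integration.integral_add) auto
    have intGR: "integrable lborel (\<lambda>y. G (hreflect l y))"
      using integrable_hreflect_iff[of G l] intG by simp
    have ball_low: "snd y < l" if "y \<in> ball x e" for y
    proof -
      have "snd y - snd x \<le> dist (snd x) (snd y)" by (simp add: dist_real_def)
      also have "\<dots> \<le> dist x y" by (rule dist_snd_le)
      also have "\<dots> < d" using that e by simp
      finally show ?thesis by (simp add: d_def)
    qed
    have G_up: "G y = 0" if "snd y \<ge> l" for y
      using that A(2) ball_low[of y] by (auto simp: G_def indicator_def)
    have low: "H y + H (hreflect l y) \<le> G y" if y: "snd y < l" for y
    proof -
      have "hreflect l y \<notin> ball x e" using ball_low[of "hreflect l y"] y by auto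
      then have HR: "H (hreflect l y) = (w x + w y) * K (x - hreflect l y)"
        by (simp add: H_def anti indicator_def)
      show ?thesis
      proof (cases "y \<in> ball x e")
        case True
        then have "dist y x < r" using e by (simp add: dist_commute)
        then have "w y - w x < 1" using r(2)[of y] by (simp add: dist_real_def)
        then have "w x + w y \<le> 1" using wx by simp
        then have "(w x + w y) * K (x - hreflect l y) \<le> 1 * K (x - hreflect l y)"
          using K0 by (rule mult_right_mono)
        moreover have "H y = 0"
          using True by (simp add: H_def)
        ultimately have "H y + H (hreflect l y) \<le> P - \<eta>"
          using Kd[of y] y by (simp add: HR P_def)
        moreover have "P - \<eta> \<le> G y"
          using True \<open>0 \<le> \<eta>\<close> by (cases "y \<in> A") (auto simp: G_def)
        ultimately show ?thesis by simp
      next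
        case False
        then have ne: "y \<noteq> x" using e by auto
        have "H y = (w x - w y) * K (x - y)"
          using False by (simp add: H_def)
        \<comment> \<open>By antisymmetry the mirror point contributes \<open>w x + w y\<close>
          times the weaker kernel. Regrouping gives two nonpositive terms, whose sum is at most
          \<open>- \<eta>\<close> on \<open>A\<close>.\<close>
        then have "H y + H (hreflect l y)
          = (w x - w y) * (K (x - y) - K (x - hreflect l y)) + 2 * w x * K (x - hreflect l y)"
          by (simp add: HR algebra_simps)
        moreover have "(w x - w y) * (K (x - y) - K (x - hreflect l y)) \<le> 0"
          using min[OF y] KK[OF y ne] by (simp add: mult_nonpos_nonneg)
        moreover have "2 * w x * K (x - hreflect l y) \<le> 0"
          using wx K0 by (simp add: mult_nonpos_nonneg)
        moreover have "G y = (if y \<in> A then - \<eta> else 0)"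
          using False by (simp add: G_def)
        ultimately show ?thesis
          using gain[of y] by (simp split: if_split)
      qed
    qed
    \<comment> \<open>Symmetrised, the bound holds on both sides of the plane. On the plane itself
      \<open>w y = 0\<close>, so \<open>H y \<le> 0\<close> while \<open>G y = 0\<close>.\<close>
    have le: "H y + H (hreflect l y) \<le> G y + G (hreflect l y)" for y
    proof (cases "snd y" l rule: linorder_cases)
      case less
      then show ?thesis using low[of y] G_up[of "hreflect l y"] by simp
    next
      case greater
      then show ?thesis using low[of "hreflect l y"] G_up[of y] by simp
    next
      case equal
      then have "hreflect l y = y" by (simp add: prod_eq_iff)
      moreover have "w y = 0" using anti[of y] \<open>hreflect l y = y\<close> by simp
      moreover have "w x * K (x - y) \<le> 0" using wx K0 by (simp add: mult_nonpos_nonneg)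
      ultimately show ?thesis using G_up[of y] equal by (simp add: H_def indicator_def)
    qed
    \<comment> \<open>By invariance of the measure each symmetrised integral is twice the plain one,
      so the factor 2 cancels.\<close>
    have "2 * I e = (LINT y|lborel. H y + H (hreflect l y))"
      using intH intHR integral_hreflect[of H l] by (simp add: IH)
    also have "\<dots> \<le> (LINT y|lborel. G y + G (hreflect l y))"
      using intH intHR intG intGR le by (intro integral_mono) auto
    also have "\<dots> = 2 * (- \<eta> * V + P * measure lborel (ball x e))"
      using intG intGR integral_hreflect[of G l] by (simp add: iG)
    finally show ?thesis by simp
  qed
  have ball0: "((\<lambda>e. measure lborel (ball x e)) \<longlongrightarrow> 0) (at_right 0)"
  proof -
    have "((\<lambda>e. unit_ball_vol (real DIM('a \<times> real)) * e ^ DIM('a \<times> real)) \<longlongrightarrow>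
        unit_ball_vol (real DIM('a \<times> real)) * 0 ^ DIM('a \<times> real)) (at_right 0)"
      by (intro tendsto_intros)
    then have "((\<lambda>e. unit_ball_vol (real DIM('a \<times> real)) * e ^ DIM('a \<times> real)) \<longlongrightarrow> 0) (at_right 0)"
      by simp
    then show ?thesis
      by (rule Lim_transform_eventually)
        (auto intro!: eventually_mono[OF eventually_at_right_less[of 0]] simp: content_ball simp del: DIM_prod)
  qed
  have "((\<lambda>e. c * (- \<eta> * V + P * measure lborel (ball x e))) \<longlongrightarrow> c * (- \<eta> * V + P * 0)) (at_right 0)"
    by (intro tendsto_intros ball0)
  moreover have "((\<lambda>e. c * I e) \<longlongrightarrow> v) (at_right 0)"
    using lap unfolding has_frac_laplacian_def I_def p_def by simp
  moreover have "eventually (\<lambda>e. c * I e \<le> c * (- \<eta> * V + P * measure lborel (ball x e))) (at_right 0)"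
  proof -
    have "eventually (\<lambda>e. e \<in> {0<..<min d r}) (at_right 0)"
      using d r by (intro eventually_at_right_real) auto
    then show ?thesis
      by eventually_elim (use I_le \<open>0 < c\<close> in auto)
  qed
  ultimately have "v \<le> c * (- \<eta> * V + P * 0)"
    by (intro tendsto_le[of "at_right (0::real)"]) auto
  then show ?thesis by (simp add: V_def)
qed

text \<open>At a zero minimum the term with \<open>2 * w x\<close> drops out, and the kernel gap
  gives a strictly negative contribution near \<open>z\<close>. On a small closed ball about
  \<open>z\<close> compactness makes this contribution uniform.\<close>

lemma frac_laplacian_antisymmetric_zero_min:
  fixes w :: "'a::euclidean_space \<times> real \<Rightarrow> real" and s c l v :: real
  assumes "0 < s" and "0 < c"
    and cont: "continuous_on UNIV w"
    and anti: "\<And>y. w (hreflect l y) = - w y"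
    and lap: "has_frac_laplacian c s w x v"
    and x: "snd x < l" and wx: "w x = 0"
    and min: "\<And>y. snd y < l \<Longrightarrow> 0 \<le> w y"
    and z: "snd z < l" "0 < w z"
  shows "v < 0"
proof -
  define p where "p = real DIM('a \<times> real) + 2 * s"
  have p: "p > 0" using assms(1) by (simp add: p_def add_pos_pos)
  define U where "U = {y. snd y < l} \<inter> {y. 0 < w y}"
  have "open U"
    unfolding U_def using cont by (intro open_Int open_Collect_less continuous_intros) auto
  moreover have "z \<in> U" using z by (simp add: U_def)
  ultimately obtain r where r: "r > 0" "cball z r \<subseteq> U"
    by (meson open_contains_cball)
  then have U: "snd y < l" "0 < w y" "y \<noteq> x" if "y \<in> cball z r" for y
    using that wx unfolding U_def by auto
  define g where "g y = w y * (1 / norm (x - y) powr p - 1 / norm (x - hreflect l y) powr p)" for y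
  have ne: "x \<noteq> hreflect l y" if "snd y < l" for y
    using that x by (auto simp: prod_eq_iff)
  have "continuous_on (cball z r) g"
    unfolding g_def using U ne
    by (intro continuous_intros continuous_on_subset[OF cont]) force+
  then obtain y0 where y0: "y0 \<in> cball z r" "\<And>y. y \<in> cball z r \<Longrightarrow> g y0 \<le> g y"
    using continuous_attains_inf[of "cball z r" g] r by (auto simp del: mem_cball)
  have pos: "g y0 > 0"
    unfolding g_def using U[OF y0(1)] inverse_norm_powr_hreflect_less[OF p x, of y0] by simp
  have "v \<le> - (c * g y0 * measure lborel (cball z r))"
  proof (rule frac_laplacian_antisymmetric_min_le[OF assms(1,2) cont anti lap x])
    show "emeasure lborel (cball z r) < \<infinity>"
      by (rule emeasure_bounded_finite) simp
    show "(w x - w y) * (1 / norm (x - y) powr (real DIM('a \<times> real) + 2 * s)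
        - 1 / norm (x - hreflect l y) powr (real DIM('a \<times> real) + 2 * s))
        + 2 * w x * (1 / norm (x - hreflect l y) powr (real DIM('a \<times> real) + 2 * s)) \<le> - g y0"
      if "y \<in> cball z r" for y
      using y0(2)[OF that] unfolding g_def p_def wx by (simp del: DIM_prod)
  qed (use wx min U pos in auto)
  moreover have "c * g y0 * measure lborel (cball z r) > 0"
    using \<open>0 < c\<close> pos r by (simp add: content_cball del: DIM_prod)
  ultimately show ?thesis by linarith
qed

text \<open>The gain set is the ball of radius d = l - x_N about \<open>x\<close>, whose mirror
  image lies within 3d of \<open>x\<close>. The term with \<open>2 * w x\<close> alone then
  contributes a multiple of w(x) d^N / (3d)^(N+2s), hence the power -2s.\<close>

lemma frac_laplacian_antisymmetric_neg_min:
  fixes w :: "'a::euclidean_space \<times> real \<Rightarrow> real" and s c l v :: real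
  assumes "0 < s" and "0 < c"
    and cont: "continuous_on UNIV w"
    and anti: "\<And>y. w (hreflect l y) = - w y"
    and lap: "has_frac_laplacian c s w x v"
    and x: "snd x < l" and wx: "w x \<le> 0"
    and min: "\<And>y. snd y < l \<Longrightarrow> w x \<le> w y"
  shows "v \<le> w x * (2 * c * unit_ball_vol (real DIM('a \<times> real))
    * 3 powr - (real DIM('a \<times> real) + 2 * s) * (l - snd x) powr - (2 * s))"
proof -
  define N where "N = DIM('a \<times> real)"
  define p where "p = real N + 2 * s"
  have p: "p > 0" using assms(1) by (simp add: p_def N_def add_pos_pos)
  define d where "d = l - snd x"
  have d: "d > 0" using x by (simp add: d_def)
  define \<eta> where "\<eta> = - 2 * w x / (3 * d) powr p"
  have low: "snd y < l" if "y \<in> ball x d" for y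
    using that dist_snd_le[of x y] by (simp add: d_def dist_real_def)
  have "v \<le> - (c * \<eta> * measure lborel (ball x d))"
  proof (rule frac_laplacian_antisymmetric_min_le[OF assms(1,2) cont anti lap x wx min])
    show "emeasure lborel (ball x d) < \<infinity>"
      by (rule emeasure_bounded_finite) simp
    show "\<eta> \<ge> 0" using wx by (simp add: \<eta>_def divide_nonpos_nonneg)
    fix y assume y: "y \<in> ball x d"
    have "norm (x - hreflect l y) \<le> norm (x - hreflect l x) + norm (hreflect l x - hreflect l y)"
      by (rule order_trans[OF _ norm_triangle_ineq]) simp
    also have "norm (x - hreflect l x) = 2 * d"
      using d by (simp add: norm_prod_def hreflect_def d_def)
    also have "norm (hreflect l x - hreflect l y) \<le> d"
      using y by (simp add: norm_hreflect_diff dist_norm)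
    finally have "norm (x - hreflect l y) \<le> 3 * d" by simp
    moreover have "norm (x - hreflect l y) > 0"
      using norm_diff_hreflect_ge[of y l x] low[OF y] x by linarith
    ultimately have "1 / (3 * d) powr p \<le> 1 / norm (x - hreflect l y) powr p"
      using p by (intro divide_left_mono powr_mono2 mult_pos_pos) auto
    then have "2 * w x * (1 / norm (x - hreflect l y) powr p) \<le> - \<eta>"
      using wx mult_left_mono_neg[of "1 / (3 * d) powr p"
          "1 / norm (x - hreflect l y) powr p" "2 * w x"]
      by (simp add: \<eta>_def)
    moreover have "(w x - w y) * (1 / norm (x - y) powr p - 1 / norm (x - hreflect l y) powr p) \<le> 0"
    proof (cases "y = x")
      case False
      then show ?thesis
        using inverse_norm_powr_hreflect_less[OF p x low[OF y]] min[OF low[OF y]]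
        by (intro mult_nonpos_nonneg) auto
    qed simp
    ultimately show "(w x - w y) * (1 / norm (x - y) powr (real DIM('a \<times> real) + 2 * s)
        - 1 / norm (x - hreflect l y) powr (real DIM('a \<times> real) + 2 * s))
        + 2 * w x * (1 / norm (x - hreflect l y) powr (real DIM('a \<times> real) + 2 * s)) \<le> - \<eta>"
      unfolding p_def N_def by linarith
  qed (use low in auto)
  also have "- (c * \<eta> * measure lborel (ball x d))
      = w x * (2 * c * unit_ball_vol (real N) * (d ^ N / (3 * d) powr p))"
    using d by (simp add: content_ball \<eta>_def N_def del: DIM_prod)
  also have "(3 * d) powr p = 3 powr p * (d ^ N * d powr (2 * s))"
    using d by (simp add: powr_mult) (simp add: p_def powr_add powr_realpow)
  also have "d ^ N / \<dots> = 3 powr - p * d powr - (2 * s)"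
    using d by (simp add: powr_minus field_simps)
  finally show ?thesis
    by (simp add: p_def N_def d_def mult.assoc del: DIM_prod)
qed

section \<open>Pointwise exterior values and compact caps of the epigraph\<close>

text \<open>If \<open>u z \<noteq> 0\<close>, the open set where \<open>u\<close> is nonzero meets
  \<open>S\<close> in a nonempty open set, which cannot be null. Allowing \<open>z\<close> in the
  closure of \<open>S\<close> is what reaches boundary points of \<Omega>.\<close>

lemma continuous_AE_eq_0_imp_eq_0:
  fixes u :: "'a::euclidean_space \<Rightarrow> real"
  assumes u: "continuous_on UNIV u" and AE: "AE x in lborel. x \<notin> \<Omega> \<longrightarrow> u x = 0"
    and S: "open S" "S \<inter> \<Omega> = {}" and z: "z \<in> closure S"
  shows "u z = 0"
proof (rule ccontr)
  assume "u z \<noteq> 0"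
  define U where "U = {y. u y \<noteq> 0}"
  have "open U"
    unfolding U_def using u by (intro open_Collect_neq continuous_intros) auto
  then have "U \<inter> S \<noteq> {}"
    using z \<open>u z \<noteq> 0\<close> by (auto simp: U_def closure_iff_nhds_not_empty)
  moreover have "open (U \<inter> S)" using \<open>open U\<close> S by blast
  moreover have "U \<inter> S \<in> null_sets lborel"
  proof -
    have "AE x in lborel. x \<notin> U \<inter> S"
      using AE by eventually_elim (use S in \<open>auto simp: U_def\<close>)
    then show ?thesis
      using \<open>open (U \<inter> S)\<close> by (subst AE_iff_null_sets) auto
  qed
  ultimately show False
    using open_not_negligible negligible_iff_null_sets null_sets_completionI by metis
qed

lemma open_strict_epigraph:
  assumes "continuous_on UNIV \<phi>"
  shows "open (strict_epigraph \<phi>)"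
  unfolding strict_epigraph_def
  by (intro open_Collect_less continuous_intros continuous_on_compose2[OF assms]) auto

lemma closure_strict_epigraph_subset:
  assumes "continuous_on UNIV \<phi>"
  shows "closure (strict_epigraph \<phi>) \<subseteq> {x. \<phi> (fst x) \<le> snd x}"
  by (rule closure_minimal)
    (auto simp: strict_epigraph_def intro!: closed_Collect_le continuous_intros
      continuous_on_compose2[OF assms])

text \<open>Coercivity confines x' to a ball where \<phi> can be at most \<open>L\<close>;
  boundedness of \<phi> on that ball bounds x_N from below.\<close>

lemma compact_closure_strict_epigraph_Int:
  fixes \<phi> :: "real ^ 'n \<Rightarrow> real"
  assumes cont: "continuous_on UNIV \<phi>" and lim: "filterlim \<phi> at_top at_infinity"
  shows "compact (closure (strict_epigraph \<phi>) \<inter> {x. snd x \<le> L})" (is "compact ?C")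
proof -
  have "eventually (\<lambda>x. \<phi> x > L) at_infinity"
    using lim by (simp add: filterlim_at_top_dense)
  then obtain b where b: "\<And>x. norm x \<ge> b \<Longrightarrow> \<phi> x > L"
    by (auto simp: eventually_at_infinity)
  have "continuous_on (cball 0 b) \<phi>"
    using cont continuous_on_subset by blast
  then have "bounded (\<phi> ` cball 0 b)"
    by (intro compact_imp_bounded compact_continuous_image) auto
  then obtain a where a: "\<forall>x\<in>cball 0 b. \<bar>\<phi> x\<bar> \<le> a"
    unfolding bounded_iff by auto
  have "?C \<subseteq> cball 0 b \<times> {- a..L}"
  proof
    fix x assume "x \<in> ?C"
    then have x: "\<phi> (fst x) \<le> snd x" "snd x \<le> L"
      using closure_strict_epigraph_subset[OF cont] by auto
    then have "norm (fst x) \<le> b" using b[of "fst x"] by fastforce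
    with a x show "x \<in> cball 0 b \<times> {- a..L}"
      by (force simp: mem_Times_iff)
  qed
  then have "bounded ?C"
    by (rule bounded_subset[rotated]) (intro bounded_Times bounded_cball bounded_closed_interval)
  moreover have "closed ?C"
    by (intro closed_Int closed_Collect_le continuous_intros) auto
  ultimately show ?thesis by (simp add: compact_eq_bounded_closed)
qed

section \<open>The moving plane argument\<close>

theorem theorem1p3:
  fixes s c :: real
    and \<phi> :: "real ^ 'n \<Rightarrow> real"
    and \<Omega> :: "((real ^ 'n) \<times> real) set"
    and f :: "(real ^ 'n) \<times> real \<Rightarrow> real \<Rightarrow> real"
    and u :: "(real ^ 'n) \<times> real \<Rightarrow> real"
  assumes "0 < s" and "s < 1" and "0 < c"
    and "continuous_on UNIV \<phi>"
    and "filterlim \<phi> at_top at_infinity"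
    and "\<Omega> = strict_epigraph \<phi>"
    and "continuous_on (closure \<Omega> \<times> UNIV) (\<lambda>(x, t). f x t)"
    and "nondecreasing_last_on (closure \<Omega>) f"
    and "locally_lipschitz_in_t_on (closure \<Omega>) f"
    and "classical_solution c s \<Omega> f (\<lambda>x. 0) u"
    and "\<forall>x\<in>\<Omega>. u x > 0"
  shows "\<forall>x' x\<^sub>N y\<^sub>N. (x', x\<^sub>N) \<in> \<Omega> \<and> y\<^sub>N > x\<^sub>N \<longrightarrow> u (x', x\<^sub>N) < u (x', y\<^sub>N)"
proof -
  note s = assms(1) and c = assms(3)
  have u: "continuous_on UNIV u"
    and lap_u: "\<And>x. x \<in> \<Omega> \<Longrightarrow> has_frac_laplacian c s u x (f x (u x))"
    and AE_u: "AE x in lborel. x \<notin> \<Omega> \<longrightarrow> u x = 0"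
    using assms(10) by (auto simp: classical_solution_def)
  have \<Omega>: "x \<in> \<Omega> \<longleftrightarrow> \<phi> (fst x) < snd x" for x
    by (simp add: assms(6) strict_epigraph_def)
  have cl: "\<phi> (fst x) \<le> snd x" if "x \<in> closure \<Omega>" for x
    using closure_strict_epigraph_subset[OF assms(4)] that assms(6) by auto
  have \<Omega>_cl: "x \<in> closure \<Omega>" if "x \<in> \<Omega>" for x
    using that closure_subset by blast
  define C where "C L = closure \<Omega> \<inter> {x. snd x \<le> L}" for L
  have compact_C: "compact (C L)" for L
    unfolding C_def assms(6) by (rule compact_closure_strict_epigraph_Int[OF assms(4,5)])
  have low_C: "\<exists>b. \<forall>x\<in>C L. - b \<le> snd x" for L
  proof -
    obtain b where "\<forall>x\<in>C L. norm x \<le> b"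
      using compact_imp_bounded[OF compact_C[of L]] unfolding bounded_iff by blast
    moreover have "- norm x \<le> snd x" for x :: "(real ^ 'n) \<times> real"
      using norm_snd_le[of "snd x" "fst x"] by simp
    ultimately show ?thesis
      by (intro exI[of _ b] ballI) (meson neg_le_iff_le order_trans)
  qed
  \<comment> \<open>Points directly below \<open>x\<close> lie strictly under the graph, so
    \<open>x\<close> is in the closure of the open exterior even when it is on the graph.\<close>
  have u_out: "u x = 0" if "x \<notin> \<Omega>" for x
  proof (rule continuous_AE_eq_0_imp_eq_0[OF u AE_u])
    let ?S = "{x. snd x < \<phi> (fst x)}"
    show "open ?S"
      by (intro open_Collect_less continuous_intros continuous_on_compose2[OF assms(4)]) auto
    show "?S \<inter> \<Omega> = {}" by (auto simp: \<Omega>)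
    have "((\<lambda>t. (fst x, t)) \<longlongrightarrow> (fst x, snd x)) (at_left (snd x))"
      by (intro tendsto_intros)
    moreover have "eventually (\<lambda>t. (fst x, t) \<in> ?S) (at_left (snd x))"
      using eventually_at_left_real[of "snd x - 1" "snd x"] that by (auto simp: \<Omega> elim!: eventually_mono)
    ultimately show "x \<in> closure ?S"
      by (intro Lim_in_closed_set[of "closure ?S"])
        (auto elim!: eventually_mono intro: closure_subset[THEN subsetD])
  qed
  have u_nonneg: "u x \<ge> 0" for x
    using u_out[of x] assms(11) by (cases "x \<in> \<Omega>") auto
  define w where "w l x = u (hreflect l x) - u x" for l x
  have anti: "w l (hreflect l x) = - w l x" for l x
    by (simp add: w_def)
  have cont_w2: "continuous_on UNIV (\<lambda>(l, x). w l x)"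
    unfolding w_def case_prod_unfold
    by (intro continuous_intros continuous_on_compose2[OF u]) auto
  have cont_w: "continuous_on UNIV (w l)" for l
    unfolding w_def by (intro continuous_intros continuous_on_compose2[OF u]) auto
  have cont_wl: "continuous_on UNIV (\<lambda>l. w l x)" for x
    unfolding w_def by (intro continuous_intros continuous_on_compose2[OF u]) auto
  have w_out: "w l x \<ge> 0" if "x \<notin> \<Omega>" for l x
    using u_out[OF that] u_nonneg by (simp add: w_def)
  have w_pos: "w l x > 0" if "x \<notin> \<Omega>" "\<phi> (fst x) < 2 * l - snd x" for l x
    using u_out[OF that(1)] that(2) assms(11) by (simp add: w_def \<Omega>)
  have refl_\<Omega>: "hreflect l x \<in> \<Omega>" if "x \<in> \<Omega>" "snd x < l" for l x
    using that by (simp add: \<Omega>)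
  define F where "F l x = f (hreflect l x) (u (hreflect l x)) - f x (u x)" for l x
  have lap_w: "has_frac_laplacian c s (w l) x (F l x)" if "x \<in> \<Omega>" "snd x < l" for l x
    unfolding w_def F_def
    by (intro has_frac_laplacian_diff has_frac_laplacian_hreflect u lap_u refl_\<Omega> that)
  \<comment> \<open>The mirror point is higher, so monotonicity of \<open>f\<close> in x_N leaves
    only a difference in the second argument.\<close>
  have F_ge: "F l x \<ge> f x (u (hreflect l x)) - f x (u x)" if "x \<in> \<Omega>" "snd x < l" for l x
  proof -
    have "f (fst x, snd x) (u (hreflect l x)) \<le> f (fst x, 2 * l - snd x) (u (hreflect l x))"
      by (rule assms(8)[unfolded nondecreasing_last_on_def, rule_format])
        (use \<Omega>_cl[OF that(1)] \<Omega>_cl[OF refl_\<Omega>[OF that]] that in \<open>simp_all add: hreflect_def\<close>)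
    then show ?thesis by (simp add: F_def hreflect_def)
  qed

  have strict: "w l x > 0" if x: "x \<in> \<Omega>" "snd x < l" and nn: "\<And>y. snd y < l \<Longrightarrow> w l y \<ge> 0" for l x
  proof (rule ccontr)
    assume "\<not> w l x > 0"
    then have wx: "w l x = 0" using nn[OF x(2)] by simp
    \<comment> \<open>\<open>z\<close> lies under the graph over the origin while its mirror image
      lies above the graph, so \<open>w l z > 0\<close>. The minimum is at most the mean of its two
      entries, which is \<open>l\<close>.\<close>
    define z where "z = (0 :: real ^ 'n, min (\<phi> 0) (2 * l - \<phi> 0) - 1)"
    have "snd z < l" by (simp add: z_def min_def)
    moreover have "w l z > 0"
      by (rule w_pos) (auto simp: z_def \<Omega>)
    ultimately have "F l x < 0"
      using frac_laplacian_antisymmetric_zero_min[OF s c cont_w anti lap_w[OF x] x(2) wx] nn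
      by blast
    moreover have "F l x \<ge> 0"
      using F_ge[OF x] wx by (simp add: w_def)
    ultimately show False by simp
  qed

  \<comment> \<open>Negative values occur only in \<Omega>, so below the plane they lie in the
    compact cap \<open>C l\<close>; a minimum over the cap is one over the half space. It is off the
    plane, where \<open>w l\<close> vanishes.\<close>
  have neg_min: "\<exists>x\<in>\<Omega>. snd x < l \<and> w l x < 0 \<and> (\<forall>y. snd y < l \<longrightarrow> w l x \<le> w l y)"
    if z: "snd z < l" "w l z < 0" for l z
  proof -
    have "z \<in> \<Omega>" using z w_out[of z l] by linarith
    then have "z \<in> C l" using z \<Omega>_cl by (simp add: C_def)
    then obtain x where x: "x \<in> C l" "\<And>y. y \<in> C l \<Longrightarrow> w l x \<le> w l y"
      using continuous_attains_inf[OF compact_C[of l], of "w l"]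
        continuous_on_subset[OF cont_w] by blast
    have wx: "w l x < 0" using x(2)[OF \<open>z \<in> C l\<close>] z by simp
    then have "x \<in> \<Omega>" using w_out[of x l] by force
    moreover have "snd x \<noteq> l"
    proof
      assume "snd x = l"
      then have "hreflect l x = x" by (simp add: prod_eq_iff)
      then show False using wx by (simp add: w_def)
    qed
    then have "snd x < l" using x(1) by (simp add: C_def)
    moreover have "w l x \<le> w l y" if "snd y < l" for y
    proof (cases "y \<in> \<Omega>")
      case True
      then show ?thesis using x(2)[of y] that \<Omega>_cl by (simp add: C_def)
    next
      case False
      then show ?thesis using w_out[of y l] wx by simp
    qed
    ultimately show ?thesis using wx by blast
  qed

  \<comment> \<open>Close to the plane the factor d^(-2s) would exceed the Lipschitz constant of
    \<open>f\<close>.\<close>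
  have depth: "\<exists>d>0. \<forall>l\<le>\<Lambda>. \<forall>x\<in>\<Omega>. snd x < l \<longrightarrow> w l x < 0 \<longrightarrow>
      (\<forall>y. snd y < l \<longrightarrow> w l x \<le> w l y) \<longrightarrow> d \<le> l - snd x" for \<Lambda>
  proof -
    obtain b where low: "\<And>x. x \<in> C \<Lambda> \<Longrightarrow> - b \<le> snd x"
      using low_C by blast
    \<comment> \<open>For \<open>x\<close> in \<open>C \<Lambda>\<close> and
      \<open>l \<le> \<Lambda>\<close>, the mirror image has height at most 2 \<Lambda> + b. So one
      compact cap contains both points and bounds both values of \<open>u\<close>.\<close>
    define L' where "L' = max \<Lambda> (2 * \<Lambda> + b)"
    have "compact (u ` C L')"
      by (intro compact_continuous_image compact_C continuous_on_subset[OF u]) auto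
    then obtain M where "M > 0" and M: "\<And>x. x \<in> C L' \<Longrightarrow> \<bar>u x\<bar> \<le> M"
      using compact_imp_bounded bounded_pos[of "u ` C L'"] by auto
    have "C \<Lambda> \<subseteq> closure \<Omega>" by (simp add: C_def)
    then obtain L where "L > 0" and L: "\<And>t \<tau> x. t \<in> {-M..M} \<Longrightarrow> \<tau> \<in> {-M..M} \<Longrightarrow> t \<noteq> \<tau> \<Longrightarrow>
        x \<in> C \<Lambda> \<Longrightarrow> \<bar>f x t - f x \<tau>\<bar> / \<bar>t - \<tau>\<bar> \<le> L"
      using assms(9)[unfolded locally_lipschitz_in_t_on_def] \<open>M > 0\<close> compact_C[of \<Lambda>] by meson
    define B where "B = 2 * c * unit_ball_vol (real DIM((real ^ 'n) \<times> real))
      * 3 powr - (real DIM((real ^ 'n) \<times> real) + 2 * s)"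
    have B: "B > 0" using c by (simp add: B_def del: DIM_prod)
    have "(B / L) powr (1 / (2 * s)) \<le> l - snd x"
      if l: "l \<le> \<Lambda>" and x: "x \<in> \<Omega>" "snd x < l" and wx: "w l x < 0"
        and min: "\<And>y. snd y < l \<Longrightarrow> w l x \<le> w l y" for l x
    proof -
      define d where "d = l - snd x"
      have d: "d > 0" using x by (simp add: d_def)
      have xC: "x \<in> C \<Lambda>" using x l \<Omega>_cl by (simp add: C_def)
      have "x \<in> C L'" using xC by (simp add: C_def L'_def le_max_iff_disj)
      moreover have "hreflect l x \<in> C L'"
        using \<Omega>_cl[OF refl_\<Omega>[OF x]] low[OF xC] l by (simp add: C_def L'_def le_max_iff_disj)
      ultimately have "\<bar>f x (u (hreflect l x)) - f x (u x)\<bar> / \<bar>w l x\<bar> \<le> L"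
        unfolding w_def using M[of x] M[of "hreflect l x"] wx xC by (intro L) (auto simp: w_def)
      then have "\<bar>f x (u (hreflect l x)) - f x (u x)\<bar> \<le> L * \<bar>w l x\<bar>"
        using wx by (subst (asm) pos_divide_le_eq) auto
      then have "L * w l x \<le> F l x"
        using F_ge[OF x] wx by simp
      also have "F l x \<le> w l x * (B * d powr - (2 * s))"
        unfolding B_def d_def
        using frac_laplacian_antisymmetric_neg_min[OF s c cont_w anti lap_w[OF x] x(2) _ min] wx
        by (simp del: DIM_prod)
      \<comment> \<open>Dividing by the negative number \<open>w l x\<close> reverses the
        inequality; solving for \<open>d\<close> yields the threshold.\<close>
      finally have "B * d powr - (2 * s) \<le> L"
        using wx by (simp add: mult.commute[of L])
      then have "B / L \<le> d powr (2 * s)"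
        using d \<open>L > 0\<close> by (simp add: powr_minus field_simps)
      then have "(B / L) powr (1 / (2 * s)) \<le> (d powr (2 * s)) powr (1 / (2 * s))"
        using s B \<open>L > 0\<close> by (intro powr_mono2) auto
      also have "\<dots> = d" using s d by (simp add: powr_powr)
      finally show ?thesis by (simp add: d_def)
    qed
    then show ?thesis
      using B \<open>L > 0\<close> by (intro exI[of _ "(B / L) powr (1 / (2 * s))"]) auto
  qed

  have nonneg: "w \<Lambda> y \<ge> 0" if "snd y < \<Lambda>" for \<Lambda> y
  proof -
    obtain d where "d > 0" and d: "\<And>l x. l \<le> \<Lambda> \<Longrightarrow> x \<in> \<Omega> \<Longrightarrow> snd x < l \<Longrightarrow> w l x < 0 \<Longrightarrow>
      (\<forall>y. snd y < l \<longrightarrow> w l x \<le> w l y) \<Longrightarrow> d \<le> l - snd x"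
      using depth[of \<Lambda>] by blast
    \<comment> \<open>The depth bound replaces the strict condition x_N < l by the closed one x_N
      \<le> l - d, so \<open>P\<close> is closed. Any negative value for some
      \<open>l \<le> \<Lambda>\<close> puts a pair into \<open>P\<close>.\<close>
    define P where "P = {(l, x). l \<le> \<Lambda> \<and> x \<in> closure \<Omega> \<and> snd x \<le> l - d \<and> w l x \<le> 0}"
    have P: "\<exists>x. (l, x) \<in> P" if "l \<le> \<Lambda>" "snd z < l" "w l z < 0" for l z
      using neg_min[OF that(2,3)] d[of l] \<Omega>_cl that(1) unfolding P_def by fastforce
    have "P = {}"
    proof (rule ccontr)
      assume "P \<noteq> {}"
      obtain b where low: "\<And>x. x \<in> C \<Lambda> \<Longrightarrow> - b \<le> snd x"
        using low_C by blast
      \<comment> \<open>The plane lies above a point of the cap \<open>C \<Lambda>\<close>, hence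
        its height is at least \<open>- b\<close>.\<close>
      have "P \<subseteq> {- b..\<Lambda>} \<times> C \<Lambda>"
      proof (clarify)
        fix l x assume lx: "(l, x) \<in> P"
        then have "x \<in> C \<Lambda>" using \<open>d > 0\<close> by (auto simp: P_def C_def)
        with lx low[of x] \<open>d > 0\<close> show "l \<in> {- b..\<Lambda>} \<and> x \<in> C \<Lambda>" by (auto simp: P_def)
      qed
      moreover have "closed P"
      proof -
        have "P = {q. fst q \<le> \<Lambda>} \<inter> (UNIV \<times> closure \<Omega>) \<inter> {q. snd (snd q) \<le> fst q - d}
            \<inter> {q. (\<lambda>(l, x). w l x) q \<le> 0}"
          by (auto simp: P_def)
        moreover have "closed \<dots>"
          using cont_w2 by (intro closed_Int closed_Collect_le closed_Times continuous_intros) auto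
        ultimately show ?thesis by simp
      qed
      ultimately have "compact P"
        using compact_Int_closed[OF compact_Times[OF compact_Icc compact_C]]
        by (metis inf.absorb_iff2)
      then obtain q where q: "q \<in> P" "\<And>q'. q' \<in> P \<Longrightarrow> fst q \<le> fst q'"
        using continuous_attains_inf[OF _ \<open>P \<noteq> {}\<close> continuous_on_fst[OF continuous_on_id]]
        by blast
      define l x where "l = fst q" and "x = snd q"
      have lx: "l \<le> \<Lambda>" "x \<in> closure \<Omega>" "snd x < l" "w l x \<le> 0"
        using q(1) \<open>d > 0\<close> by (auto simp: P_def l_def x_def)
      \<comment> \<open>For k slightly below \<open>l\<close>, a negative value of
        \<open>w k\<close> would give a pair in \<open>P\<close> with a smaller first entry. Let k
        tend to \<open>l\<close>.\<close>
      have nn: "w l y \<ge> 0" if "snd y < l" for y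
      proof (rule tendsto_lowerbound)
        show "((\<lambda>l. w l y) \<longlongrightarrow> w l y) (at_left l)"
          using cont_wl[of y] by (metis UNIV_I continuous_on_def tendsto_within_subset subset_UNIV)
        have "eventually (\<lambda>k. k \<in> {snd y<..<l}) (at_left l)"
          using that by (rule eventually_at_left_real)
        then show "eventually (\<lambda>k. 0 \<le> w k y) (at_left l)"
        proof eventually_elim
          case (elim k)
          show ?case
          proof (rule ccontr)
            assume "\<not> 0 \<le> w k y"
            then obtain x' where "(k, x') \<in> P" using P[of k y] elim lx(1) by auto
            then show False using q(2)[of "(k, x')"] elim by (simp add: l_def)
          qed
        qed
      qed simp
      show False
      \<comment> \<open>Inside \<Omega> the zero-minimum argument \<open>strict\<close> applies. On
        the boundary the mirror image lies in \<Omega>, so \<open>w l x > 0\<close>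
        directly.\<close>
      proof (cases "x \<in> \<Omega>")
        case True
        then show False using strict[of x l] nn lx by fastforce
      next
        case False
        then show False using w_pos[of x l] cl[OF lx(2)] lx by (simp add: \<Omega>)
      qed
    qed
    then show ?thesis using P[of \<Lambda> y] that by force
  qed

  show ?thesis
  proof (intro allI impI, elim conjE)
    fix x' and a b :: real
    assume "(x', a) \<in> \<Omega>" and "a < b"
    \<comment> \<open>The plane midway between the two heights exchanges the two points.\<close>
    then have "w ((a + b) / 2) (x', a) > 0"
      by (intro strict nonneg) auto
    then show "u (x', a) < u (x', b)"
      by (simp add: w_def hreflect_def add_divide_distrib)
  qed
qed

end
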